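(* Let $(\mathbb S,+,\Box,\partial)$ be a monotonic arithmetical semiring and let $p$ be the smallest integer such that $\mathbb S^\Box(p)\neq0$. Then \[ \mathbb S^+(n)-\mathbb S^\Box(n)=\mathbb S^\Box(p)\,\mathbb S^+\!\left(\frac np\right)+O\left(\mathbb S\left(\left\lfloor\frac n{p+1}\right\rfloor+p+1\right)\right). \] Moreover, if axiom $\mathcal G_1^+$ holds then axiom $\mathcal G_1^\Box$ also holds.
   Context: An arithmetical semiring is a tuple $(\mathbb S,+,\Box,\partial)$ where: $(\mathbb S,+)$ is a commutative monoid with identity $\mathbf e_+$ which is free on a set $\mathbb S^+\subseteq\mathbb S\setminus\{\mathbf e_+\}$ (additive primes); $\Box$ is a commutative associative operation distributive over $+$ making $\mathbb S\setminus\{\mathbf e_+\}$ a commutative monoid with identity $\mathbf e_\Box$; $\partial:\mathbb S\to\mathbb R_{\ge0}$ satisfies $\partial(A+B)=\partial(A)+\partial(B)$ and $\partial(A\Box B)=\partial(A)\partial(B)$; $\partial^{-1}(0)=\{\mathbf e_+\}$; each $\partial^{-1}(x)$ is finite and is empty unless $x$ is an integer; $(\mathbb S^+,\Box)$ is a free commutative monoid with identity $\mathbf e_\Box$ on a set $\mathbb S^\Box\subseteq\mathbb S^+\setminus\{\mathbf e_\Box\}$ (multiplicative primes); and $\mathbf e_\Box$ is the only additive prime of degree $1$. For real $x\ge0$, $\mathbb S(x)$, $\mathbb S^+(x)$, $\mathbb S^\Box(x)$ denote the numbers of elements of $\mathbb S$, $\mathbb S^+$, $\mathbb S^\Box$ of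 degree $x$ (zero if $x$ is not an integer). Monotonic: there is $N$ with $\mathbb S^+(n)\le\mathbb S^+(n+1)$ for all $n\ge N$. The $O$-term means the difference $\mathbb S^+(n)-\mathbb S^\Box(n)-\mathbb S^\Box(p)\mathbb S^+(n/p)$ is bounded in absolute value by $C\,\mathbb S(\lfloor n/(p+1)\rfloor+p+1)$ for a constant $C$ and all large $n$. For nonnegative sequences, $a_n=o(b_n)$ means for all $\epsilon>0$, $a_n\le\epsilon b_n$ for large $n$, and $a_n\sim b_n$ means $a_n-b_n=o(a_n)$. Axiom $\mathcal G_1^+$: $\mathbb S(n)\sim\mathbb S^+(n)$. Axiom $\mathcal G_1^\Box$: $\mathbb S^+(n)\sim\mathbb S^\Box(n)$. *)

theory Defs
  imports "HOL-Algebra.Ring" "HOL-Library.Multiset" "HOL-Library.Landau_Symbols"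
begin

text \<open>
  Freeness on \<open>P\<close> as existence and uniqueness of factorizations: evaluation is a bijection from
  the finite multisets over \<open>P\<close> onto the monoid.
\<close>

definition free_comm_monoid_on :: "('a, 'b) monoid_scheme \<Rightarrow> 'a set \<Rightarrow> bool" where
  "free_comm_monoid_on G P \<longleftrightarrow>
     comm_monoid G \<and> P \<subseteq> carrier G \<and>
     bij_betw (\<lambda>X. finprod G (\<lambda>p. p [^]\<^bsub>G\<^esub> count X p) (set_mset X))
       {X. set_mset X \<subseteq> P} (carrier G)"

definition deg_count :: "('a \<Rightarrow> real) \<Rightarrow> 'a set \<Rightarrow> real \<Rightarrow> nat" where
  "deg_count deg A x = card {a \<in> A. deg a = x}"

text \<open>
  The sets \<open>Sp\<close> and \<open>Sb\<close> of additive and multiplicative primes are parameters; freeness determines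
  them uniquely from the remaining data.
\<close>

locale arithmetical_semiring =
  fixes R :: "('a, 'b) ring_scheme" (structure)
    and deg :: "'a \<Rightarrow> real"
    and Sp Sb :: "'a set"
  assumes add_free: "free_comm_monoid_on (add_monoid R) Sp"
    and Sp_subset: "Sp \<subseteq> carrier R - {\<zero>}"
    and box_closed: "\<lbrakk>a \<in> carrier R; b \<in> carrier R\<rbrakk> \<Longrightarrow> a \<otimes> b \<in> carrier R"
    and box_assoc: "\<lbrakk>a \<in> carrier R; b \<in> carrier R; c \<in> carrier R\<rbrakk>
          \<Longrightarrow> (a \<otimes> b) \<otimes> c = a \<otimes> (b \<otimes> c)"
    and box_comm: "\<lbrakk>a \<in> carrier R; b \<in> carrier R\<rbrakk> \<Longrightarrow> a \<otimes> b = b \<otimes> a"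
    and box_distrib: "\<lbrakk>a \<in> carrier R; b \<in> carrier R; c \<in> carrier R\<rbrakk>
          \<Longrightarrow> a \<otimes> (b \<oplus> c) = (a \<otimes> b) \<oplus> (a \<otimes> c)"
    and box_monoid: "comm_monoid (R\<lparr>carrier := carrier R - {\<zero>}\<rparr>)"
    and deg_nonneg: "a \<in> carrier R \<Longrightarrow> 0 \<le> deg a"
    and deg_add: "\<lbrakk>a \<in> carrier R; b \<in> carrier R\<rbrakk> \<Longrightarrow> deg (a \<oplus> b) = deg a + deg b"
    and deg_box: "\<lbrakk>a \<in> carrier R; b \<in> carrier R\<rbrakk> \<Longrightarrow> deg (a \<otimes> b) = deg a * deg b"
    and deg_zero: "{a \<in> carrier R. deg a = 0} = {\<zero>}"
    and deg_finite: "finite {a \<in> carrier R. deg a = x}"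
    and deg_integral: "x \<notin> \<int> \<Longrightarrow> {a \<in> carrier R. deg a = x} = {}"
    and box_free: "free_comm_monoid_on (R\<lparr>carrier := Sp\<rparr>) Sb"
    and Sb_subset: "Sb \<subseteq> Sp - {\<one>}"
    and deg_one_prime: "{a \<in> Sp. deg a = 1} = {\<one>}"

locale monotonic_arithmetical_semiring = arithmetical_semiring +
  assumes monotonic:
    "\<exists>N::nat. \<forall>n\<ge>N. deg_count deg Sp (real n) \<le> deg_count deg Sp (real (n + 1))"

definition seq_equiv :: "(nat \<Rightarrow> real) \<Rightarrow> (nat \<Rightarrow> real) \<Rightarrow> bool" where
  "seq_equiv a b \<longleftrightarrow> (\<lambda>n. a n - b n) \<in> o(a)"

definition axiom_G1_plus :: "('a, 'b) ring_scheme \<Rightarrow> ('a \<Rightarrow> real) \<Rightarrow> 'a set \<Rightarrow> bool" where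
  "axiom_G1_plus R deg Sp \<longleftrightarrow>
     seq_equiv (\<lambda>n. real (deg_count deg (carrier R) (real n))) (\<lambda>n. real (deg_count deg Sp (real n)))"

definition axiom_G1_box :: "('a \<Rightarrow> real) \<Rightarrow> 'a set \<Rightarrow> 'a set \<Rightarrow> bool" where
  "axiom_G1_box deg Sp Sb \<longleftrightarrow>
     seq_equiv (\<lambda>n. real (deg_count deg Sp (real n))) (\<lambda>n. real (deg_count deg Sb (real n)))"

end

theory Submission imports Defs begin

text \<open>
  Every multiplicatively composite additive prime of degree \<open>n > p\<close> either has a prime divisor of
  degree \<open>p\<close> or is a product \<open>B \<box> C\<close> with both degrees at least \<open>p + 1\<close>.  The first kind is
  covered by the pairs (prime of degree \<open>p\<close>, cofactor of degree \<open>n / p\<close>), and overcounting requires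
  two distinct prime divisors of degree \<open>p\<close>, hence a cofactor of degree \<open>n / p\<^sup>2\<close>.  In the second
  case \<open>deg B + deg C \<le> n / (p + 1) + p + 1\<close> by convexity; padding the sum \<open>B + C\<close> with copies of
  \<open>\<one>\<close> gives an element of degree exactly \<open>\<lfloor>n / (p + 1)\<rfloor> + p + 1\<close> from which unique additive
  factorization recovers \<open>{B, C}\<close>.

  For the second claim, adding \<open>\<one>\<close> embeds the elements of degree \<open>n - 1\<close> into the elements of
  degree \<open>n\<close> that are not additive primes, so \<open>\<S>(n - 1) \<le> \<S>(n) - \<S>\<^sup>+(n) = o(\<S>(n))\<close>.
\<close>

section \<open>Evaluation of multisets in a commutative monoid\<close>

definition mset_prod :: "('a, 'b) monoid_scheme \<Rightarrow> 'a multiset \<Rightarrow> 'a" where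
  "mset_prod G X = finprod G (\<lambda>p. p [^]\<^bsub>G\<^esub> count X p) (set_mset X)"

context comm_monoid
begin

lemma mset_prod_closed: "set_mset X \<subseteq> carrier G \<Longrightarrow> mset_prod G X \<in> carrier G"
  unfolding mset_prod_def by (rule finprod_closed) auto

text \<open>Indices outside the support carry exponent 0 and contribute the unit. This lets several
  multisets be evaluated over one common index set, as additivity requires.\<close>

lemma mset_prod_superset:
  assumes "set_mset X \<subseteq> F" "finite F" "F \<subseteq> carrier G"
  shows "mset_prod G X = finprod G (\<lambda>p. p [^] count X p) F"
  unfolding mset_prod_def
  by (rule finprod_mono_neutral_cong_left) (use assms in \<open>auto simp: not_in_iff\<close>)

lemma mset_prod_union:
  assumes "set_mset X \<subseteq> carrier G" "set_mset Y \<subseteq> carrier G"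
  shows "mset_prod G (X + Y) = mset_prod G X \<otimes> mset_prod G Y"
proof -
  let ?F = "set_mset X \<union> set_mset Y"
  have "mset_prod G (X + Y) = finprod G (\<lambda>p. p [^] count X p \<otimes> p [^] count Y p) ?F"
    by (subst mset_prod_superset[of _ ?F])
       (use assms in \<open>auto simp: nat_pow_mult intro!: finprod_cong'\<close>)
  also have "\<dots> = finprod G (\<lambda>p. p [^] count X p) ?F \<otimes> finprod G (\<lambda>p. p [^] count Y p) ?F"
    by (rule finprod_multf) (use assms in auto)
  also have "\<dots> = mset_prod G X \<otimes> mset_prod G Y"
    using assms by (simp add: mset_prod_superset[of _ ?F])
  finally show ?thesis .
qed

lemma mset_prod_empty [simp]: "mset_prod G {#} = \<one>"
  by (simp add: mset_prod_def)

lemma mset_prod_single: "x \<in> carrier G \<Longrightarrow> mset_prod G {#x#} = x"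
  by (simp add: mset_prod_def)

lemma mset_prod_add_mset:
  "\<lbrakk>x \<in> carrier G; set_mset X \<subseteq> carrier G\<rbrakk> \<Longrightarrow> mset_prod G (add_mset x X) = x \<otimes> mset_prod G X"
  using mset_prod_union[of "{#x#}" X] by (simp add: mset_prod_single)

end

section \<open>Unique factorization in free commutative monoids\<close>

context
  fixes G :: "('a, 'b) monoid_scheme" and P
  assumes free: "free_comm_monoid_on G P"
begin

lemma free_comm_monoidD: "comm_monoid G" "P \<subseteq> carrier G"
  using free by (auto simp: free_comm_monoid_on_def)

lemma free_factorization:
  assumes "a \<in> carrier G"
  obtains X where "set_mset X \<subseteq> P" "mset_prod G X = a"
proof -
  have "a \<in> mset_prod G ` {X. set_mset X \<subseteq> P}"
    using free assms by (auto simp: free_comm_monoid_on_def bij_betw_def mset_prod_def [abs_def])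
  then show ?thesis using that by auto
qed

lemma free_factorization_unique:
  "\<lbrakk>set_mset X \<subseteq> P; set_mset Y \<subseteq> P; mset_prod G X = mset_prod G Y\<rbrakk> \<Longrightarrow> X = Y"
  using free by (auto simp: free_comm_monoid_on_def bij_betw_def inj_on_def mset_prod_def)

end

section \<open>Additive and multiplicative factorizations and their degrees\<close>

context arithmetical_semiring
begin

abbreviation msum :: "'a multiset \<Rightarrow> 'a" where
  "msum \<equiv> mset_prod (add_monoid R)"

abbreviation mbox :: "'a multiset \<Rightarrow> 'a" where
  "mbox \<equiv> mset_prod (R\<lparr>carrier := Sp\<rparr>)"

lemma Sp_carrier: "a \<in> Sp \<Longrightarrow> a \<in> carrier R"
  using Sp_subset by auto

lemma Sb_Sp: "a \<in> Sb \<Longrightarrow> a \<in> Sp"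
  using Sb_subset by auto

lemma one_Sp: "\<one> \<in> Sp" and deg_one: "deg \<one> = 1"
  using deg_one_prime by auto

lemma msum_add_mset:
  assumes "a \<in> Sp" "set_mset X \<subseteq> Sp"
  shows "msum (add_mset a X) = a \<oplus> msum X"
  using comm_monoid.mset_prod_add_mset[OF free_comm_monoidD(1)[OF add_free], of a X] assms Sp_carrier
  by auto

lemma msum_closed: "set_mset X \<subseteq> Sp \<Longrightarrow> msum X \<in> carrier R"
  using comm_monoid.mset_prod_closed[OF free_comm_monoidD(1)[OF add_free], of X] Sp_carrier
  by auto

lemma msum_single: "a \<in> Sp \<Longrightarrow> msum {#a#} = a"
  using comm_monoid.mset_prod_single[OF free_comm_monoidD(1)[OF add_free], of a] Sp_carrier
  by auto

lemma mbox_add_mset: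
  assumes "a \<in> Sp" "set_mset X \<subseteq> Sp"
  shows "mbox (add_mset a X) = a \<otimes> mbox X"
  using comm_monoid.mset_prod_add_mset[OF free_comm_monoidD(1)[OF box_free], of a X] assms
  by auto

lemma mbox_closed: "set_mset X \<subseteq> Sp \<Longrightarrow> mbox X \<in> Sp"
  using comm_monoid.mset_prod_closed[OF free_comm_monoidD(1)[OF box_free], of X]
  by auto

lemma mbox_single: "a \<in> Sp \<Longrightarrow> mbox {#a#} = a"
  using comm_monoid.mset_prod_single[OF free_comm_monoidD(1)[OF box_free], of a]
  by auto

lemma mbox_empty: "mbox {#} = \<one>"
  using comm_monoid.mset_prod_empty[OF free_comm_monoidD(1)[OF box_free]] by simp

lemma box_Sp: "\<lbrakk>a \<in> Sp; b \<in> Sp\<rbrakk> \<Longrightarrow> a \<otimes> b \<in> Sp"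
  using monoid.m_closed[OF comm_monoid.axioms(1)[OF free_comm_monoidD(1)[OF box_free]], of a b]
  by simp

lemma mbox_factorization:
  assumes "a \<in> Sp"
  obtains X where "set_mset X \<subseteq> Sb" "mbox X = a"
  using free_factorization[OF box_free, of a] assms by auto

lemma msum_factorization:
  assumes "a \<in> carrier R"
  obtains X where "set_mset X \<subseteq> Sp" "msum X = a"
  using free_factorization[OF add_free, of a] assms by auto

lemmas mbox_unique = free_factorization_unique[OF box_free]
lemmas msum_unique = free_factorization_unique[OF add_free]

lemma deg_msum: "set_mset X \<subseteq> Sp \<Longrightarrow> deg (msum X) = sum_mset (image_mset deg X)"
proof (induction X)
  case empty
  have "msum {#} = \<zero>"
    using comm_monoid.mset_prod_empty[OF free_comm_monoidD(1)[OF add_free]] by simp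
  then show ?case using deg_zero by auto
next
  case (add a X)
  then show ?case by (simp add: msum_add_mset deg_add Sp_carrier msum_closed)
qed

lemma deg_eq_nat:
  assumes "a \<in> carrier R"
  obtains m where "deg a = real m"
proof -
  have "deg a \<in> \<int>" using assms deg_integral[of "deg a"] by blast
  then show ?thesis
    using that deg_nonneg[OF assms]
    by (metis Ints_cases nonneg_int_cases of_int_0_le_iff of_int_of_nat_eq)
qed

lemma deg_Sp_ge_1:
  assumes "a \<in> Sp"
  shows "deg a \<ge> 1"
proof -
  have "a \<in> carrier R" "a \<noteq> \<zero>" using assms Sp_subset by auto
  moreover obtain m where "deg a = real m" using calculation deg_eq_nat by metis
  ultimately show ?thesis using deg_zero by (cases m) auto
qed

lemma finite_deg_Sp: "finite {a \<in> Sp. deg a = x}"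
  by (rule finite_subset[OF _ deg_finite[of x]]) (auto intro: Sp_carrier)

lemma finite_deg_Sb: "finite {a \<in> Sb. deg a = x}"
  by (rule finite_subset[OF _ finite_deg_Sp[of x]]) (auto intro: Sb_Sp)

section \<open>Growth of the counting function under adding \<open>\<one>\<close>\<close>

lemma deg_count_Sp_le: "deg_count deg Sp x \<le> deg_count deg (carrier R) x"
  unfolding deg_count_def by (rule card_mono[OF deg_finite]) (auto intro: Sp_carrier)

text \<open>Adding \<open>\<one>\<close> inserts one more copy of \<open>\<one>\<close> into the
  additive factorization, so cancellation of multisets gives cancellation in the semiring.\<close>

lemma add_one_inj: "inj_on (\<lambda>a. \<one> \<oplus> a) (carrier R)"
proof (rule inj_onI)
  fix a b assume "a \<in> carrier R" "b \<in> carrier R" and eq: "\<one> \<oplus> a = \<one> \<oplus> b"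
  then obtain X Y where XY: "set_mset X \<subseteq> Sp" "msum X = a" "set_mset Y \<subseteq> Sp" "msum Y = b"
    by (metis msum_factorization)
  then have "add_mset \<one> X = add_mset \<one> Y"
    using eq by (intro msum_unique) (auto simp: msum_add_mset one_Sp)
  then show "a = b" using XY by auto
qed

text \<open>An additive prime has only its singleton factorization, which would have to contain the
  summand \<open>\<one>\<close>; then \<open>\<one> \<oplus> a = \<one>\<close>, and comparing
  degrees forces \<open>a\<close> to be zero.\<close>

lemma one_add_notin_Sp:
  assumes "a \<in> carrier R" "a \<noteq> \<zero>"
  shows "\<one> \<oplus> a \<notin> Sp"
proof
  assume *: "\<one> \<oplus> a \<in> Sp"
  obtain X where X: "set_mset X \<subseteq> Sp" "msum X = a" using assms msum_factorization by metis
  then have "add_mset \<one> X = {#\<one> \<oplus> a#}"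
    using * X msum_single[OF *] by (intro msum_unique) (auto simp: msum_add_mset one_Sp)
  then have "\<one> \<oplus> a = \<one>" by (auto simp: single_is_union)
  then have "deg a = 0" using assms deg_add[of \<one> a] one_Sp Sp_carrier by auto
  then show False using assms deg_zero by auto
qed

lemma image_one_add:
  "(\<lambda>a. \<one> \<oplus> a) ` {a \<in> carrier R. deg a = real n} \<subseteq> {a \<in> carrier R. deg a = real (Suc n)}"
proof -
  have "\<one> \<oplus> a \<in> carrier R" if "a \<in> carrier R" for a
    using monoid.m_closed[OF comm_monoid.axioms(1)[OF free_comm_monoidD(1)[OF add_free]], of \<one> a]
      that one_Sp Sp_carrier by auto
  then show ?thesis by (auto simp: deg_add one_Sp Sp_carrier deg_one)
qed

lemma card_image_one_add:
  "card ((\<lambda>a. \<one> \<oplus> a) ` {a \<in> carrier R. deg a = real n}) = deg_count deg (carrier R) (real n)"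
  unfolding deg_count_def by (rule card_image) (use add_one_inj in \<open>auto simp: inj_on_def\<close>)

lemma deg_count_mono:
  assumes "m \<le> n"
  shows "deg_count deg (carrier R) (real m) \<le> deg_count deg (carrier R) (real n)"
proof -
  have "deg_count deg (carrier R) (real n) \<le> deg_count deg (carrier R) (real (Suc n))" for n
    using card_mono[OF deg_finite image_one_add, of n] card_image_one_add[of n]
    by (simp add: deg_count_def)
  from lift_Suc_mono_le[where f="\<lambda>n. deg_count deg (carrier R) (real n)", OF this assms]
  show ?thesis .
qed

text \<open>The elements \<open>\<one> \<oplus> a\<close> are disjoint from the additive primes.
  Positivity of \<open>n\<close> excludes \<open>a = \<zero>\<close>, whose image
  \<open>\<one>\<close> is itself prime.\<close>

lemma deg_count_Suc:
  assumes "n > 0"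
  shows "deg_count deg (carrier R) (real n) + deg_count deg Sp (real (Suc n))
    \<le> deg_count deg (carrier R) (real (Suc n))"
proof -
  let ?A = "(\<lambda>a. \<one> \<oplus> a) ` {a \<in> carrier R. deg a = real n}"
  let ?B = "{a \<in> Sp. deg a = real (Suc n)}"
  have "\<one> \<oplus> a \<notin> Sp" if "a \<in> carrier R" "deg a = real n" for a
  proof (rule one_add_notin_Sp)
    have "deg \<zero> = 0" using deg_zero by blast
    then show "a \<noteq> \<zero>" using that assms by auto
  qed (fact that)
  then have "?A \<inter> ?B = {}" by auto
  then have "card ?A + card ?B = card (?A \<union> ?B)"
    by (intro card_Un_disjoint[symmetric] finite_imageI deg_finite finite_deg_Sp)
  also have "\<dots> \<le> card {a \<in> carrier R. deg a = real (Suc n)}"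
    by (rule card_mono[OF deg_finite]) (use image_one_add Sp_carrier in blast)
  finally show ?thesis using card_image_one_add by (simp add: deg_count_def)
qed

text \<open>Stated for real \<open>x\<close> because it is applied to quotients such as
  \<open>n / p\<close>. If \<open>x\<close> is not a degree the count is 0; otherwise
  \<open>x\<close> is a natural number and monotonicity of the total count applies.\<close>

lemma deg_count_le_bound:
  assumes "x \<le> real N"
  shows "deg_count deg Sp x \<le> deg_count deg (carrier R) (real N)"
proof (cases "\<exists>a \<in> carrier R. deg a = x")
  case True
  then obtain m where m: "x = real m" using deg_eq_nat by metis
  then show ?thesis using deg_count_Sp_le[of x] deg_count_mono[of m N] assms by simp
next
  case False
  then have "{a \<in> Sp. deg a = x} = {}" using Sp_carrier by auto
  then show ?thesis by (simp only: deg_count_def) simp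
qed

end

section \<open>Composite primes and the least degree of a multiplicative prime\<close>

locale least_prime_degree = arithmetical_semiring +
  fixes p :: nat
  assumes p_count: "deg_count deg Sb (real p) \<noteq> 0"
    and p_least: "q < p \<Longrightarrow> deg_count deg Sb (real q) = 0"
begin

lemma Sb_deg:
  assumes "q \<in> Sb"
  shows "deg q = real p \<or> deg q \<ge> real (p + 1)"
proof -
  obtain m where m: "deg q = real m" using assms Sb_Sp Sp_carrier deg_eq_nat by metis
  have "\<not> m < p"
    using p_least[of m] m assms finite_deg_Sb[of "real m"] by (auto simp: deg_count_def)
  then show ?thesis using m by auto
qed

text \<open>Multiplicative primes differ from \<open>\<one>\<close>, the only additive prime of
  degree 1.\<close>

lemma p_ge_2: "p \<ge> 2"
proof -
  obtain q where q: "q \<in> Sb" "deg q = real p"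
    using p_count unfolding deg_count_def by (metis (mono_tags, lifting) card.empty empty_Collect_eq)
  then have "q \<in> Sp" "q \<noteq> \<one>" using Sb_subset by auto
  moreover have "deg q \<ge> 1" using calculation deg_Sp_ge_1 by auto
  moreover have "deg q \<noteq> 1" using calculation deg_one_prime by auto
  ultimately show ?thesis using q by auto
qed

definition composites :: "nat \<Rightarrow> 'a set" where
  "composites n = {a \<in> Sp. deg a = real n \<and> a \<notin> Sb}"

text \<open>The quotient is taken in the reals, so the set is empty when \<open>p\<close> does not
  divide \<open>n\<close>, and its cardinality is exactly the main term for every
  \<open>n\<close>.\<close>

definition factor_pairs :: "nat \<Rightarrow> ('a \<times> 'a) set" where
  "factor_pairs n = {q \<in> Sb. deg q = real p} \<times> {b \<in> Sp. deg b = real n / real p}"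

definition p_multiples :: "nat \<Rightarrow> 'a set" where
  "p_multiples n = (\<lambda>(q, b). q \<otimes> b) ` factor_pairs n"

lemma card_composites:
  "real (card (composites n)) = real (deg_count deg Sp (real n)) - real (deg_count deg Sb (real n))"
proof -
  have "composites n = {a \<in> Sp. deg a = real n} - {a \<in> Sb. deg a = real n}"
    by (auto simp: composites_def)
  moreover have "{a \<in> Sb. deg a = real n} \<subseteq> {a \<in> Sp. deg a = real n}" by (auto intro: Sb_Sp)
  ultimately show ?thesis
    by (simp add: deg_count_def card_Diff_subset finite_deg_Sb finite_deg_Sp card_mono of_nat_diff)
qed

lemma card_factor_pairs:
  "card (factor_pairs n) = deg_count deg Sb (real p) * deg_count deg Sp (real n / real p)"
  by (simp add: factor_pairs_def deg_count_def card_cartesian_product)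

lemma finite_factor_pairs: "finite (factor_pairs n)"
  by (simp add: factor_pairs_def finite_deg_Sb finite_deg_Sp)

text \<open>A product \<open>q \<otimes> b\<close> that is a multiplicative prime must equal its
  factor \<open>q\<close>. The condition \<open>n > p\<close> rules this out by degree; it excludes
  the cofactor \<open>\<one>\<close>.\<close>

lemma p_multiples_composite:
  assumes "n > p"
  shows "p_multiples n \<subseteq> composites n"
proof
  fix a assume "a \<in> p_multiples n"
  then obtain q b where qb: "q \<in> Sb" "deg q = real p" "b \<in> Sp" "deg b = real n / real p" "a = q \<otimes> b"
    by (auto simp: p_multiples_def factor_pairs_def)
  have "deg a = real n"
    using qb p_ge_2 by (simp add: deg_box Sb_Sp Sp_carrier)
  moreover have "a \<in> Sp" using qb box_Sp Sb_Sp by auto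
  moreover have "a \<notin> Sb"
  proof
    assume "a \<in> Sb"
    obtain X where X: "set_mset X \<subseteq> Sb" "mbox X = b" using qb mbox_factorization by metis
    have sp: "set_mset X \<subseteq> Sp" using X Sb_Sp by auto
    have "add_mset q X = {#a#}"
      using \<open>a \<in> Sb\<close> qb X sp mbox_single[of a]
      by (intro mbox_unique) (auto simp: mbox_add_mset Sb_Sp)
    then have "a = q" by (auto simp: single_is_union)
    then show False using \<open>deg a = real n\<close> qb assms by simp
  qed
  ultimately show "a \<in> composites n" by (simp add: composites_def)
qed

text \<open>Multiplication of pairs can only collide when the cofactor has a further prime divisor
  of degree \<open>p\<close>. Off the set \<open>K\<close> of pairs with such a cofactor it is
  injective, and \<open>K\<close> is parametrized by two primes of degree \<open>p\<close> and an
  element of degree \<open>n / p\<^sup>2\<close>.\<close>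

lemma card_factor_pairs_le:
  "card (factor_pairs n) \<le> card (p_multiples n)
     + (deg_count deg Sb (real p))\<^sup>2 * deg_count deg Sp (real n / real p / real p)"
proof -
  let ?P = "{q \<in> Sb. deg q = real p}" and ?D = "{b \<in> Sp. deg b = real n / real p / real p}"
  let ?f = "\<lambda>(q, b). q \<otimes> b"
  define K where "K = (\<lambda>(q, r, d). (q, r \<otimes> d)) ` (?P \<times> ?P \<times> ?D)"
  have finK: "finite K" unfolding K_def by (intro finite_imageI finite_cartesian_product finite_deg_Sb finite_deg_Sp)
  have cardK: "card K \<le> (deg_count deg Sb (real p))\<^sup>2 * deg_count deg Sp (real n / real p / real p)"
  proof -
    have "card K \<le> card (?P \<times> ?P \<times> ?D)"
      unfolding K_def by (intro card_image_le finite_cartesian_product finite_deg_Sb finite_deg_Sp)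
    then show ?thesis by (simp add: card_cartesian_product deg_count_def power2_eq_square)
  qed
  have inj: "inj_on ?f (factor_pairs n - K)"
  proof (rule inj_onI, clarsimp)
    fix q b q' b'
    assume qb: "(q, b) \<in> factor_pairs n" "(q, b) \<notin> K" "(q', b') \<in> factor_pairs n"
      and eq: "q \<otimes> b = q' \<otimes> b'"
    have m: "q \<in> Sb" "q' \<in> Sb" "b \<in> Sp" "b' \<in> Sp" "deg q = real p" "deg q' = real p"
      "deg b = real n / real p"
      using qb by (auto simp: factor_pairs_def)
    obtain X Y where XY: "set_mset X \<subseteq> Sb" "mbox X = b" "set_mset Y \<subseteq> Sb" "mbox Y = b'"
      using m by (metis mbox_factorization)
    have sp: "set_mset X \<subseteq> Sp" "set_mset Y \<subseteq> Sp" using XY Sb_Sp by auto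
    have XYeq: "add_mset q X = add_mset q' Y"
      using m XY sp eq by (intro mbox_unique) (auto simp: mbox_add_mset Sb_Sp)
    have "q = q'"
    proof (rule ccontr)
      assume "q \<noteq> q'"
      \<comment> \<open>Two equal multisets with different distinguished elements: \<open>q'\<close>
        must already occur among the prime factors of \<open>b\<close>.\<close>
      then obtain Z where Z: "X = add_mset q' Z" using XYeq by (auto simp: add_eq_conv_ex)
      then have b: "b = q' \<otimes> mbox Z" "mbox Z \<in> Sp"
        using XY sp m by (auto simp: mbox_add_mset Sb_Sp mbox_closed)
      then have "deg b = real p * deg (mbox Z)" using m by (simp add: deg_box Sb_Sp Sp_carrier)
      then have "deg (mbox Z) = real n / real p / real p" using m p_ge_2 by (simp add: field_simps)
      then have "(q, b) \<in> K" unfolding K_def using m b by (auto simp: image_iff)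
      then show False using qb by simp
    qed
    then show "q = q' \<and> b = b'" using XYeq XY by auto
  qed
  have "card (factor_pairs n) - card K \<le> card (factor_pairs n - K)"
    by (rule diff_card_le_card_Diff[OF finK])
  also have "\<dots> = card (?f ` (factor_pairs n - K))" using inj by (simp add: card_image)
  also have "\<dots> \<le> card (p_multiples n)"
    unfolding p_multiples_def by (intro card_mono finite_imageI finite_factor_pairs) auto
  finally show ?thesis using cardK by linarith
qed

text \<open>Without a prime factor of degree \<open>p\<close>, all prime factors have degree at
  least \<open>p + 1\<close>. There are at least two of them, so one factor and the product of the
  others serve as \<open>b\<close> and \<open>c\<close>.\<close>

lemma composite_split:
  assumes "n > p" "a \<in> composites n - p_multiples n"
  shows "\<exists>b c. b \<in> Sp \<and> c \<in> Sp \<and> a = b \<otimes> c \<and> deg b \<ge> real (p + 1) \<and> deg c \<ge> real (p + 1)"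
proof -
  have a: "a \<in> Sp" "deg a = real n" "a \<notin> Sb" "a \<notin> p_multiples n"
    using assms by (auto simp: composites_def)
  obtain X where X: "set_mset X \<subseteq> Sb" "mbox X = a" using a mbox_factorization by metis
  have sp: "set_mset X \<subseteq> Sp" using X Sb_Sp by auto
  have big: "deg q \<ge> real (p + 1)" if q_in: "q \<in># X" for q
  proof (rule ccontr)
    assume "\<not> ?thesis"
    then have q: "deg q = real p" "q \<in> Sb" using Sb_deg X q_in by auto
    obtain Z where Z: "X = add_mset q Z" using multi_member_split[OF q_in] by blast
    then have b: "a = q \<otimes> mbox Z" "mbox Z \<in> Sp"
      using X sp by (auto simp: mbox_add_mset mbox_closed)
    then have "deg a = real p * deg (mbox Z)" using q by (simp add: deg_box Sb_Sp Sp_carrier)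
    then have "deg (mbox Z) = real n / real p" using a p_ge_2 by (simp add: field_simps)
    then have "a \<in> p_multiples n"
      unfolding p_multiples_def factor_pairs_def using q b by (auto simp: image_iff)
    then show False using a by simp
  qed
  have "X \<noteq> {#}"
  proof
    assume "X = {#}"
    then have "deg a = 1" using X mbox_empty deg_one by simp
    then show False using a assms p_ge_2 by simp
  qed
  then obtain q Y where Y: "X = add_mset q Y" by (cases X) auto
  \<comment> \<open>A single prime factor would make \<open>a\<close> itself a multiplicative
    prime.\<close>
  have "Y \<noteq> {#}" using Y X a sp by (auto simp: mbox_single)
  then obtain r Z where Z: "Y = add_mset r Z" by (cases Y) auto
  have "deg (mbox Y) = deg r * deg (mbox Z)"
    using Z Y sp by (simp add: mbox_add_mset deg_box Sp_carrier mbox_closed)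
  moreover have "deg (mbox Z) \<ge> 1" using Z Y sp by (intro deg_Sp_ge_1 mbox_closed) auto
  moreover have "deg r \<ge> real (p + 1)" using big Y Z by auto
  ultimately have "deg (mbox Y) \<ge> real (p + 1)"
    using mult_mono[of "real (p + 1)" "deg r" 1 "deg (mbox Z)"] by simp
  moreover have "a = q \<otimes> mbox Y" "q \<in> Sp" "mbox Y \<in> Sp" "deg q \<ge> real (p + 1)"
    using X Y sp big by (auto simp: mbox_add_mset mbox_closed)
  ultimately show ?thesis by blast
qed

section \<open>Counting the remaining composites and the error estimate\<close>

definition bound :: "nat \<Rightarrow> nat" where
  "bound n = n div (p + 1) + p + 1"

lemma real_bound: "real_of_int (\<lfloor>real n / real (p + 1)\<rfloor> + int p + 1) = real (bound n)"
  unfolding bound_def floor_divide_of_nat_eq by simp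

text \<open>Since \<open>m\<close> is an integer, the quotient may be replaced by its floor.\<close>

lemma real_le_bound: "real m \<le> real n / real (p + 1) + real (p + 1) \<Longrightarrow> m \<le> bound n"
proof -
  assume "real m \<le> real n / real (p + 1) + real (p + 1)"
  then have "real_of_int (int m - int p - 1) \<le> real n / real (p + 1)" by simp
  then have "int m - int p - 1 \<le> \<lfloor>real n / real (p + 1)\<rfloor>" by (simp only: le_floor_iff)
  then show ?thesis unfolding bound_def floor_divide_of_nat_eq by linarith
qed

text \<open>With one splitting fixed for each element, the padded sum of the two factors is an
  injection into the elements of degree \<open>bound n\<close>.\<close>

lemma card_non_multiples:
  assumes "n > p"
  shows "card (composites n - p_multiples n) \<le> deg_count deg (carrier R) (real (bound n))"
proof -
  let ?E = "composites n - p_multiples n"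
  obtain B C where BC: "\<And>a. a \<in> ?E \<Longrightarrow> B a \<in> Sp \<and> C a \<in> Sp \<and> a = B a \<otimes> C a \<and>
      deg (B a) \<ge> real (p + 1) \<and> deg (C a) \<ge> real (p + 1)"
    using composite_split[OF assms] by metis
  \<comment> \<open>The number of copies of \<open>\<one>\<close> needed to reach degree
    \<open>bound n\<close>; the truncated subtractions are exact by the estimate of the degree sum
    below.\<close>
  define k where "k a = bound n - nat \<lfloor>deg (B a)\<rfloor> - nat \<lfloor>deg (C a)\<rfloor>" for a
  define M where "M a = {#B a, C a#} + replicate_mset (k a) \<one>" for a
  have MSp: "set_mset (M a) \<subseteq> Sp" if "a \<in> ?E" for a
    using BC[OF that] one_Sp by (auto simp: M_def)
  have deg: "deg (msum (M a)) = real (bound n)" if "a \<in> ?E" for a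
  proof -
    let ?x = "deg (B a)" and ?y = "deg (C a)" and ?q = "real (p + 1)"
    note h = BC[OF that]
    have xy: "?x * ?y = real n"
      using h that deg_box[of "B a" "C a"] Sp_carrier by (auto simp: composites_def)
    \<comment> \<open>The convexity estimate: expanding this product with \<open>?x * ?y = n\<close>
      bounds the sum of the two degrees.\<close>
    have "0 \<le> (?x - ?q) * (?y - ?q)" using h by (intro mult_nonneg_nonneg) auto
    then have "?q * (?x + ?y) \<le> real n + ?q * ?q" by (simp add: xy[symmetric] algebra_simps)
    then have le: "?x + ?y \<le> real n / ?q + ?q" by (simp add: field_simps)
    have i: "?x = real (nat \<lfloor>?x\<rfloor>)" "?y = real (nat \<lfloor>?y\<rfloor>)"
      using h Sp_carrier deg_eq_nat by (metis floor_of_nat nat_int)+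
    have "nat \<lfloor>?x\<rfloor> + nat \<lfloor>?y\<rfloor> \<le> bound n" by (rule real_le_bound) (use le i in simp)
    then have "real (k a) = real (bound n) - ?x - ?y" unfolding k_def using i by (simp add: of_nat_diff)
    then show ?thesis unfolding deg_msum[OF MSp[OF that]] by (simp add: M_def deg_one)
  qed
  have inj: "inj_on (\<lambda>a. msum (M a)) ?E"
  proof (rule inj_onI)
    fix a b assume ab: "a \<in> ?E" "b \<in> ?E" "msum (M a) = msum (M b)"
    have "M a = M b" using msum_unique ab MSp by blast
    \<comment> \<open>Dropping the copies of \<open>\<one>\<close> removes precisely the padding,
      since both factors have degree greater than 1. What is left is the unordered pair, which
      determines the product by commutativity.\<close>
    then have "filter_mset (\<lambda>x. x \<noteq> \<one>) (M a) = filter_mset (\<lambda>x. x \<noteq> \<one>) (M b)" by simp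
    moreover have "filter_mset (\<lambda>x. x \<noteq> \<one>) (M c) = {#B c, C c#}" if "c \<in> ?E" for c
    proof -
      have "B c \<noteq> \<one>" "C c \<noteq> \<one>" using BC[OF that] p_ge_2 deg_one by auto
      then show ?thesis by (simp add: M_def)
    qed
    ultimately have "{#B a, C a#} = {#B b, C b#}" using ab by simp
    then have "B a = B b \<and> C a = C b \<or> B a = C b \<and> C a = B b"
      by (auto simp: add_eq_conv_ex)
    then show "a = b"
      using BC[OF ab(1)] BC[OF ab(2)] box_comm Sp_carrier by metis
  qed
  show ?thesis unfolding deg_count_def
    by (rule card_inj_on_le[OF inj _ deg_finite]) (use deg MSp msum_closed in auto)
qed

text \<open>The main term \<open>card (factor_pairs n)\<close> exceeds the number of
  \<open>p_multiples\<close> by at most the collision term, and the composites exceed that number by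
  at most \<open>?S\<close>. The constant collects the 1 from the latter and the square from the
  former.\<close>

lemma prime_count_error:
  assumes "n > p"
  shows "\<bar>real (deg_count deg Sp (real n)) - real (deg_count deg Sb (real n))
     - real (deg_count deg Sb (real p)) * real (deg_count deg Sp (real n / real p))\<bar>
     \<le> (1 + (real (deg_count deg Sb (real p)))\<^sup>2) * real (deg_count deg (carrier R) (real (bound n)))"
proof -
  let ?S = "deg_count deg (carrier R) (real (bound n))" and ?b = "deg_count deg Sb (real p)"
  have "finite (composites n)"
    by (rule finite_subset[OF _ finite_deg_Sp[of "real n"]]) (auto simp: composites_def)
  then have comp: "card (composites n) = card (p_multiples n) + card (composites n - p_multiples n)"
    using p_multiples_composite[OF assms]
    by (simp add: card_Diff_subset card_mono finite_subset)
  have "real n / real p / real p \<le> real (bound n)"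
  proof -
    \<comment> \<open>This is what places the collision degree \<open>n / p\<^sup>2\<close> below
      \<open>bound n\<close>.\<close>
    have "p + 1 \<le> p * p" using p_ge_2 mult_le_mono1[of 2 p p] by linarith
    then have "real (p + 1) \<le> real p * real p" by (simp only: flip: of_nat_mult of_nat_le_iff)
    then have "real n / real p / real p \<le> real n / real (p + 1)"
      using p_ge_2 by (simp add: divide_divide_eq_left frac_le)
    moreover have "real n / real (p + 1) \<le> real (bound n)"
      using real_bound[of n] by linarith
    ultimately show ?thesis by linarith
  qed
  then have "?b\<^sup>2 * deg_count deg Sp (real n / real p / real p) \<le> ?b\<^sup>2 * ?S"
    by (intro mult_le_mono deg_count_le_bound) auto
  then have l: "card (factor_pairs n) \<le> card (p_multiples n) + ?b\<^sup>2 * ?S"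
    using card_factor_pairs_le[of n] by linarith
  have u: "card (p_multiples n) \<le> card (factor_pairs n)"
    unfolding p_multiples_def by (rule card_image_le[OF finite_factor_pairs])
  have "\<bar>real (card (composites n)) - real (card (factor_pairs n))\<bar> \<le> real (?S + ?b\<^sup>2 * ?S)"
    using l u comp card_non_multiples[OF assms] by linarith
  then show ?thesis
    unfolding card_composites card_factor_pairs by (simp add: algebra_simps)
qed

section \<open>The asymptotic formula and the transfer between the two axioms\<close>

lemma prime_count_bigo:
  "(\<lambda>n. real (deg_count deg Sp (real n)) - real (deg_count deg Sb (real n))
     - real (deg_count deg Sb (real p)) * real (deg_count deg Sp (real n / real p)))
   \<in> O(\<lambda>n. real (deg_count deg (carrier R) (real (bound n))))"
  by (rule bigoI[of _ "1 + (real (deg_count deg Sb (real p)))\<^sup>2"],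
      rule eventually_mono[OF eventually_gt_at_top[of p]])
     (use prime_count_error in simp)

text \<open>The total count at \<open>n - 1\<close> is negligible against the additive prime count
  at \<open>n\<close>. It dominates both the main term and the error term, because
  \<open>n / p\<close> and \<open>bound n\<close> are eventually at most
  \<open>n - 1\<close>.\<close>

lemma G1_box_if_G1_plus:
  assumes "axiom_G1_plus R deg Sp"
  shows "axiom_G1_box deg Sp Sb"
proof -
  let ?S = "\<lambda>n. real (deg_count deg (carrier R) (real n))"
  let ?s = "\<lambda>n. real (deg_count deg Sp (real n))"
  let ?T = "\<lambda>n. ?S (n - 1)"
  have o: "(\<lambda>n. ?S n - ?s n) \<in> o(?S)"
    using assms by (simp add: axiom_G1_plus_def seq_equiv_def)
  have "?T \<in> O(\<lambda>n. ?S n - ?s n)"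
  proof (rule bigoI[of _ 1], rule eventually_mono[OF eventually_gt_at_top[of 1]])
    fix n :: nat assume "1 < n"
    then obtain m where "n = Suc m" "m > 0" by (cases n) auto
    then show "norm (?T n) \<le> 1 * norm (?S n - ?s n)" using deg_count_Suc[of m] by simp
  qed
  also note o
  \<comment> \<open>The hypothesis gives smallness relative to \<open>?S\<close>, the goal asks for
    it relative to \<open>?s\<close>. Once \<open>?S - ?s\<close> is at most half of
    \<open>?S\<close>, the factor 2 suffices.\<close>
  also have "?S \<in> O(?s)"
  proof (rule bigoI[of _ 2])
    have "eventually (\<lambda>n. norm (?S n - ?s n) \<le> 1/2 * norm (?S n)) sequentially"
      by (rule landau_o.smallD[OF o]) simp
    then show "eventually (\<lambda>n. norm (?S n) \<le> 2 * norm (?s n)) sequentially"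
      by eventually_elim (simp add: abs_if split: if_splits)
  qed
  finally have T: "?T \<in> o(?s)" .
  have "eventually (\<lambda>n. bound n \<le> n - 1) sequentially"
  \<comment> \<open>The quotient in \<open>bound n\<close> is at most \<open>n / 2\<close>, so any
    \<open>n\<close> from \<open>2 * (p + 2)\<close> on would do; the threshold is generous.\<close>
  proof (rule eventually_mono[OF eventually_ge_at_top[of "4 * (p + 2)"]])
    fix n assume n: "4 * (p + 2) \<le> n"
    define d where "d = n div (p + 1)"
    have "2 * d \<le> (p + 1) * d" using p_ge_2 by (intro mult_le_mono1) simp
    also have "\<dots> \<le> n" unfolding d_def by (rule times_div_less_eq_dividend)
    finally show "bound n \<le> n - 1" using n unfolding bound_def d_def[symmetric] by presburger
  qed
  then have "(\<lambda>n. ?S (bound n)) \<in> O(?T)"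
    by (intro bigoI[of _ 1]) (auto elim!: eventually_mono intro: deg_count_mono)
  then have 1: "(\<lambda>n. ?S (bound n)) \<in> o(?s)" using T by (rule landau_o.big_small_trans)
  have "(\<lambda>n. real (deg_count deg Sp (real n / real p))) \<in> O(?T)"
  proof (rule bigoI[of _ 1], rule eventually_mono[OF eventually_ge_at_top[of 2]])
    fix n :: nat assume "2 \<le> n"
    have "real n / real p \<le> real n / 2" using p_ge_2 by (intro divide_left_mono) auto
    also have "\<dots> \<le> real (n - 1)" using \<open>2 \<le> n\<close> by (simp add: of_nat_diff)
    finally show "norm (real (deg_count deg Sp (real n / real p))) \<le> 1 * norm (?T n)"
      using deg_count_le_bound by simp
  qed
  then have "(\<lambda>n. real (deg_count deg Sp (real n / real p))) \<in> o(?s)"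
    using T by (rule landau_o.big_small_trans)
  then have 2: "(\<lambda>n. real (deg_count deg Sb (real p)) * real (deg_count deg Sp (real n / real p))) \<in> o(?s)"
    by simp
  show ?thesis unfolding axiom_G1_box_def seq_equiv_def
    \<comment> \<open>Adding the main term back to the error leaves the difference of the two prime
      counts.\<close>
    using sum_in_smallo(1)[OF landau_o.big_small_trans[OF prime_count_bigo 1] 2] by simp
qed

end

theorem theorem3p15:
  fixes R :: "('a, 'b) ring_scheme"
    and deg :: "'a \<Rightarrow> real"
    and Sp Sb :: "'a set"
    and p :: nat
  assumes "monotonic_arithmetical_semiring R deg Sp Sb"
    and "deg_count deg Sb (real p) \<noteq> 0"
    and "\<And>q::nat. q < p \<Longrightarrow> deg_count deg Sb (real q) = 0"
  shows "(\<lambda>n::nat. real (deg_count deg Sp (real n)) - real (deg_count deg Sb (real n))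
             - real (deg_count deg Sb (real p)) * real (deg_count deg Sp (real n / real p)))
           \<in> O(\<lambda>n. real (deg_count deg (carrier R)
                 (real_of_int (\<lfloor>real n / real (p + 1)\<rfloor> + int p + 1))))
       \<and> (axiom_G1_plus R deg Sp \<longrightarrow> axiom_G1_box deg Sp Sb)"
proof -
  interpret least_prime_degree R deg Sp Sb p
    using assms by (auto intro!: least_prime_degree.intro least_prime_degree_axioms.intro
        simp: monotonic_arithmetical_semiring_def)
  show ?thesis
    unfolding real_bound using prime_count_bigo G1_box_if_G1_plus by blast
qed

end
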